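(* Let $q>0$ be an integer and let $X$ be a vertex transitive $(q+1)$-regular graph with spectral measure $\mu$ for the Laplacian (at a fixed vertex $x_0$). Let $$\zeta_X(u)=\exp\left\{\sum_{m=1}^\infty \frac{N_m^0}{m}u^m\right\},$$ where $N_m^0$ is the number of closed geodesics of length $m$ starting at the fixed vertex $x_0$. Then, for all $u$ with $|u|$ sufficiently small, $$\zeta_X(u)^{-1}=(1-u^2)^{(q-1)/2}\exp\left(\int \log\bigl(1-(q+1-\lambda)u+qu^2\bigr)\,d\mu(\lambda)\right).$$
   Context: A graph $X$ consists of a set $VX$ of vertices, a set $EX$ of (oriented) edges, maps $o,t:EX\to VX$ (origin and terminus), and a map $y\mapsto\overline{y}$ on $EX$ with $\overline{\overline{y}}=y$, $\overline{y}\ne y$, $o(y)=t(\overline{y})$ for all $y\in EX$ (loops and multiple edges are allowed). The degree of a vertex $x$ is the number of $y\in EX$ with $o(y)=x$; $X$ is $d$-regular if every vertex has degree $d$. $X$ is vertex transitive if there is a group of automorphisms acting transitively on the vertices. The graph may be finite or infinite. A path of length $n$ is a sequence of edges $y_0,\dots,y_{n-1}$ with $t(y_i)=o(y_{i+1})$; it has backtracking if $y_{i+1}=\overline{y_i}$ for some $i$, and it has a tail if $y_0=\overline{y_{n-1}}$. It is closed if its initial and final vertices agree. A closed geodesic is a closed path with no backtracking and no tail. For a $(q+1)$-regular graph $X$, the Laplacian on functions $f$ on $VX$ is $\Delta f(x)=(q+1)f(x)-\sum_{e:\,o(e)=x} f(t(e))$; it is a bounded nonnegative self-adjoint operator on $L^2(VX)$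 with spectrum in $[0,2(q+1)]$. The heat kernel $K_X(t,x_0,x)$, $t\ge 0$, is the unique bounded solution of $\Delta K_X(t,x_0,x)+\frac{\partial}{\partial t}K_X(t,x_0,x)=0$ (with $\Delta$ acting in $x$), $K_X(0,x_0,x)=1$ if $x=x_0$ and $0$ otherwise. The spectral measure $\mu=\mu_{x_0}$ is the spectral measure of $\Delta$ at $x_0$, i.e. the positive measure with $K_X(t,x_0,x_0)=\int e^{-\lambda t}\,d\mu(\lambda)$ for all $t\ge0$. The logarithm and the power $(1-u^2)^{(q-1)/2}$ are the principal branches (taking the values $0$ and $1$ at $u=0$). *)

theory Defs
  imports "HOL-Analysis.Analysis" "Graph_Theory.Bidirected_Digraph" "Graph_Theory.Arc_Walk"
begin

text \<open>
  Graphs are the library's bidirected digraphs: \<open>arcs X\<close> is the set of oriented edges,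
  \<open>tail X\<close> and \<open>head X\<close> are origin and terminus, and \<open>bar\<close> is the fixed-point free edge inversion
  (the identity outside \<open>arcs X\<close>, by the convention of \<^locale>\<open>bidirected_digraph\<close>).
\<close>

definition regular_graph :: "('a, 'b) pre_digraph \<Rightarrow> nat \<Rightarrow> bool" where
  "regular_graph X d \<longleftrightarrow>
     (\<forall>x\<in>verts X. finite (out_arcs X x) \<and> out_degree X x = d)"

definition graph_automorphism ::
    "('a, 'b) pre_digraph \<Rightarrow> ('b \<Rightarrow> 'b) \<Rightarrow> ('a \<Rightarrow> 'a) \<Rightarrow> ('b \<Rightarrow> 'b) \<Rightarrow> bool" where
  "graph_automorphism X bar \<phi> \<psi> \<longleftrightarrow>
     bij_betw \<phi> (verts X) (verts X) \<and> bij_betw \<psi> (arcs X) (arcs X) \<and>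
     (\<forall>y\<in>arcs X. tail X (\<psi> y) = \<phi> (tail X y) \<and>
                  head X (\<psi> y) = \<phi> (head X y) \<and>
                  \<psi> (bar y) = bar (\<psi> y))"

definition vertex_transitive :: "('a, 'b) pre_digraph \<Rightarrow> ('b \<Rightarrow> 'b) \<Rightarrow> bool" where
  "vertex_transitive X bar \<longleftrightarrow>
     (\<forall>x\<in>verts X. \<forall>x'\<in>verts X. \<exists>\<phi> \<psi>. graph_automorphism X bar \<phi> \<psi> \<and> \<phi> x = x')"

definition backtracking :: "('b \<Rightarrow> 'b) \<Rightarrow> 'b list \<Rightarrow> bool" where
  "backtracking bar p \<longleftrightarrow> (\<exists>i. Suc i < length p \<and> p ! Suc i = bar (p ! i))"

definition has_tail :: "('b \<Rightarrow> 'b) \<Rightarrow> 'b list \<Rightarrow> bool" where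
  "has_tail bar p \<longleftrightarrow> p \<noteq> [] \<and> hd p = bar (last p)"

definition closed_geodesic ::
    "('a, 'b) pre_digraph \<Rightarrow> ('b \<Rightarrow> 'b) \<Rightarrow> 'a \<Rightarrow> 'b list \<Rightarrow> bool" where
  "closed_geodesic X bar x p \<longleftrightarrow>
     pre_digraph.awalk X x p x \<and> \<not> backtracking bar p \<and> \<not> has_tail bar p"

definition num_closed_geodesics ::
    "('a, 'b) pre_digraph \<Rightarrow> ('b \<Rightarrow> 'b) \<Rightarrow> 'a \<Rightarrow> nat \<Rightarrow> nat" where
  "num_closed_geodesics X bar x m = card {p. closed_geodesic X bar x p \<and> length p = m}"

text \<open>The logarithm of the zeta function; the index \<open>m\<close> stands for length \<open>m + 1\<close>.\<close>

definition log_zeta_term ::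
    "('a, 'b) pre_digraph \<Rightarrow> ('b \<Rightarrow> 'b) \<Rightarrow> 'a \<Rightarrow> complex \<Rightarrow> nat \<Rightarrow> complex" where
  "log_zeta_term X bar x u m =
     of_nat (num_closed_geodesics X bar x (Suc m)) / of_nat (Suc m) * u ^ Suc m"

definition graph_zeta ::
    "('a, 'b) pre_digraph \<Rightarrow> ('b \<Rightarrow> 'b) \<Rightarrow> 'a \<Rightarrow> complex \<Rightarrow> complex" where
  "graph_zeta X bar x u = exp (\<Sum>m. log_zeta_term X bar x u m)"

definition laplacian :: "('a, 'b) pre_digraph \<Rightarrow> nat \<Rightarrow> ('a \<Rightarrow> real) \<Rightarrow> 'a \<Rightarrow> real" where
  "laplacian X q f x = (real q + 1) * f x - (\<Sum>e\<in>out_arcs X x. f (head X e))"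

text \<open>\<open>K t x\<close> is the value of the heat kernel based at \<open>x0\<close>; at \<open>t = 0\<close> the time derivative is
  one-sided.\<close>

definition is_heat_kernel ::
    "('a, 'b) pre_digraph \<Rightarrow> nat \<Rightarrow> 'a \<Rightarrow> (real \<Rightarrow> 'a \<Rightarrow> real) \<Rightarrow> bool" where
  "is_heat_kernel X q x0 K \<longleftrightarrow>
     (\<exists>B. \<forall>t\<ge>0. \<forall>x\<in>verts X. \<bar>K t x\<bar> \<le> B) \<and>
     (\<forall>t\<ge>0. \<forall>x\<in>verts X. \<exists>D.
        ((\<lambda>s. K s x) has_real_derivative D) (at t within {0..}) \<and>
        laplacian X q (K t) x + D = 0) \<and>
     (\<forall>x\<in>verts X. K 0 x = (if x = x0 then 1 else 0))"

text \<open>No condition on the support is imposed: the Laplace transform identity forces \<open>\<mu>\<close> to be a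
  probability measure concentrated on the spectrum of the Laplacian.\<close>

definition is_spectral_measure ::
    "('a, 'b) pre_digraph \<Rightarrow> nat \<Rightarrow> 'a \<Rightarrow> real measure \<Rightarrow> bool" where
  "is_spectral_measure X q x0 \<mu> \<longleftrightarrow>
     sets \<mu> = sets borel \<and>
     (\<exists>K. is_heat_kernel X q x0 K \<and>
          (\<forall>t\<ge>0. has_bochner_integral \<mu> (\<lambda>l. exp (- l * t)) (K t x0)))"

end

theory Submission
  imports Defs "HOL-Complex_Analysis.Cauchy_Integral_Theorem"
begin

text \<open>
  The formula compares two power series in \<open>u\<close> coefficient by coefficient. Write \<open>a = q + 1 - \<lambda>\<close> and factor
  \<open>1 - a u + q u\<^sup>2 = (1 - \<alpha> u) (1 - \<beta> u)\<close>, where \<open>\<alpha>\<close>, \<open>\<beta>\<close> are the roots of \<open>z\<^sup>2 - a z + q\<close>. Expanding logarithms, the claim becomes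
  \<open>N m = \<integral> \<alpha> ^ m + \<beta> ^ m d\<mu> + (q - 1) [m even]\<close>, where \<open>N m\<close> is the number of closed geodesics of length \<open>m\<close>
  at \<open>x0\<close>; the second summand is responsible for the factor \<open>(1 - u\<^sup>2) powr ((q - 1) / 2)\<close>.

  The number \<open>c m\<close> of closed non-backtracking walks, with or without tail, is a polynomial in the adjacency
  operator evaluated at \<open>x0\<close>: prolonging a walk by one arc gives a three-term recursion (\<open>nb_between_rec\<close>). The
  step from \<open>c m\<close> to \<open>N m\<close> is the combinatorial heart. Cutting off a tail
  \<open>e\<close>, \<open>bar e\<close> moves the base point to a neighbour, and in an infinite graph there is no sum over
  all base points that would absorb this move. Instead, the numbers of walks with tail \<open>e\<close>, \<open>bar e\<close> and
  with tail \<open>bar e\<close>, \<open>e\<close> are shown to agree (\<open>tailed_bar\<close>), by an induction on the length that combines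
  the reversal symmetry of non-backtracking walks with the fact that, by vertex transitivity, \<open>c m\<close> is the same at all
  vertices. Then \<open>N (m + 2) - N m = c (m + 2) - q c m\<close> for \<open>m \<ge> 1\<close> (\<open>nb_cyclic_rec\<close>), which is the recursion
  satisfied by the power sums of \<open>\<alpha>\<close>, \<open>\<beta>\<close> (\<open>lucas_poly_nb_poly\<close>).

  On the analytic side, everything needed about \<open>\<mu>\<close> is extracted from its Laplace transform
  (\<open>spectral_measure_properties\<close>). Boundedness of the heat kernel excludes negative \<open>\<lambda>\<close>. The time derivatives of the heat
  kernel at \<open>0\<close> are the iterated Laplacians of the point mass, and monotone convergence identifies them with
  the moments of \<open>\<mu>\<close> (\<open>moments_of_Laplace_derivatives\<close>). The Laplacian is bounded by \<open>2 (q + 1)\<close>, so the moments grow at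
  most geometrically and \<open>\<mu>\<close> is carried by \<open>{0..2 (q + 1)}\<close>. Hence \<open>\<alpha>\<close>, \<open>\<beta>\<close> are uniformly bounded on the
  support, the logarithmic series converges uniformly for small \<open>u\<close>, and it can be integrated term by term.
\<close>

section \<open>Non-backtracking walks as matrix entries\<close>

locale regular_bidirected = bidirected_digraph X bar
  for X :: "('a, 'b) pre_digraph" and bar :: "'b \<Rightarrow> 'b" +
  fixes q :: nat
  assumes regular: "regular_graph X (q + 1)"
begin

lemma finite_out_arcs [simp]: "finite (out_arcs X x)"
proof (cases "x \<in> verts X")
  case False
  then have "out_arcs X x = {}" by auto
  then show ?thesis by simp
qed (use regular in \<open>simp add: regular_graph_def\<close>)

lemma card_out_arcs: "x \<in> verts X \<Longrightarrow> card (out_arcs X x) = q + 1"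
  using regular by (auto simp: regular_graph_def out_degree_def)

abbreviation successors :: "'b \<Rightarrow> 'b set" where
  "successors e \<equiv> out_arcs X (head X e) - {bar e}"

text \<open>
  The number of non-backtracking walks of length \<open>n + 1\<close> with first arc \<open>e\<close> and last arc \<open>e'\<close>, that is,
  the \<open>(e, e')\<close> entry of the \<open>n\<close>-th power of the non-backtracking operator on arcs. Real values are
  used because the recursions below subtract.
\<close>

primrec nb_walks :: "nat \<Rightarrow> 'b \<Rightarrow> 'b \<Rightarrow> real" where
  "nb_walks 0 e e' = of_bool (e = e')"
| "nb_walks (Suc n) e e' = (\<Sum>f\<in>successors e. nb_walks n f e')"

text \<open>
  The two ways of writing the \<open>(n + 1)\<close>-st power of a matrix, splitting off the first or the
  last factor. The arcs ending at a vertex are parametrised as the inverses of those starting there.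
\<close>

lemma nb_walks_Suc_right:
  assumes "e \<in> arcs X" "e' \<in> arcs X"
  shows "nb_walks (Suc n) e e' = (\<Sum>f\<in>out_arcs X (tail X e') - {e'}. nb_walks n e (bar f))"
  using assms
proof (induction n arbitrary: e)
  case 0
  have "(e = bar f) = (f = bar e)" for f
    by auto
  then have r: "(\<Sum>f\<in>out_arcs X (tail X e') - {e'}. nb_walks 0 e (bar f)) =
      of_bool (bar e \<in> out_arcs X (tail X e') - {e'})"
    by (simp add: of_bool_def sum.delta)
  have l: "nb_walks (Suc 0) e e' = of_bool (e' \<in> successors e)"
    by (simp add: of_bool_def sum.delta')
  show ?case
    unfolding l r using 0 by auto
next
  case (Suc n)
  have "nb_walks (Suc (Suc n)) e e' = (\<Sum>f\<in>successors e. nb_walks (Suc n) f e')"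
    by simp
  also have "\<dots> = (\<Sum>f\<in>successors e. \<Sum>g\<in>out_arcs X (tail X e') - {e'}. nb_walks n f (bar g))"
    using Suc.prems by (intro sum.cong refl Suc.IH) auto
  also have "\<dots> = (\<Sum>g\<in>out_arcs X (tail X e') - {e'}. \<Sum>f\<in>successors e. nb_walks n f (bar g))"
    by (rule sum.swap)
  finally show ?case by simp
qed

text \<open>
  Traversing a walk backwards; with the first-arc recursion on one side this becomes the last-arc
  recursion on the other.
\<close>

lemma nb_walks_reverse:
  assumes "e \<in> arcs X" "e' \<in> arcs X"
  shows "nb_walks n (bar e') (bar e) = nb_walks n e e'"
  using assms
proof (induction n arbitrary: e')
  case 0
  then show ?case by (auto simp: arev_eq_iff)
next
  case (Suc n)
  have "nb_walks (Suc n) (bar e') (bar e) =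
      (\<Sum>f\<in>out_arcs X (tail X e') - {e'}. nb_walks n f (bar e))"
    using Suc.prems by simp
  also have "\<dots> = (\<Sum>f\<in>out_arcs X (tail X e') - {e'}. nb_walks n e (bar f))"
  proof (intro sum.cong refl)
    fix f assume "f \<in> out_arcs X (tail X e') - {e'}"
    then show "nb_walks n f (bar e) = nb_walks n e (bar f)"
      using Suc.IH[of "bar f"] Suc.prems by simp
  qed
  also have "\<dots> = nb_walks (Suc n) e e'"
    using Suc.prems by (simp only: nb_walks_Suc_right)
  finally show ?case .
qed

text \<open>
  Closed non-backtracking walks of length \<open>n + 1\<close> at \<open>x\<close>; a tail, that is, a last arc inverse to the
  first, is permitted.
\<close>

definition nb_closed :: "nat \<Rightarrow> 'a \<Rightarrow> real" where
  "nb_closed n x = (\<Sum>e\<in>out_arcs X x. \<Sum>f\<in>out_arcs X x. nb_walks n e (bar f))"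

text \<open>
  The last arc \<open>bar f\<close> of a closed walk starting with \<open>e\<close> either allows \<open>e\<close> to follow it, which makes the
  walk cyclically reduced and closes it up to a diagonal entry of the next power, or is the inverse of
  \<open>e\<close>, which is a tail.
\<close>

lemma sum_closing_arc:
  assumes "e \<in> out_arcs X x"
  shows "(\<Sum>f\<in>out_arcs X x. nb_walks n e (bar f)) = nb_walks (Suc n) e e + nb_walks n e (bar e)"
proof -
  have "(\<Sum>f\<in>out_arcs X x. nb_walks n e (bar f)) =
      nb_walks n e (bar e) + (\<Sum>f\<in>out_arcs X x - {e}. nb_walks n e (bar f))"
    using assms by (intro sum.remove) auto
  also have "(\<Sum>f\<in>out_arcs X x - {e}. nb_walks n e (bar f)) = nb_walks (Suc n) e e"
    using assms nb_walks_Suc_right[of e e n] by simp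
  finally show ?thesis by simp
qed

lemma nb_closed_eq:
  "nb_closed n x = (\<Sum>e\<in>out_arcs X x. nb_walks (Suc n) e e) + (\<Sum>e\<in>out_arcs X x. nb_walks n e (bar e))"
  unfolding nb_closed_def sum.distrib[symmetric] by (intro sum.cong refl sum_closing_arc)

text \<open>
  Removing the tail \<open>e\<close>, \<open>bar e\<close> of a walk leaves a closed non-backtracking walk at \<open>head X e\<close> that neither
  starts with \<open>bar e\<close> nor ends with \<open>e\<close>. Inclusion and exclusion over these two conditions gives the formula: the walks violating one
  of them are the cyclically reduced ones through \<open>bar e\<close> or \<open>e\<close>, which are equally many by reversal, together with
  the tailed ones, and the walks violating both are exactly the tailed ones.
\<close>

lemma tailed_rec:
  assumes e: "e \<in> arcs X"
  shows "nb_walks (Suc (Suc n)) e (bar e) =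
    nb_closed n (head X e) - 2 * nb_walks (Suc n) e e - nb_walks n (bar e) e"
proof -
  define A where "A = out_arcs X (head X e)"
  have a: "bar e \<in> A" "finite A"
    using e by (auto simp: A_def)
  have "nb_closed n (head X e) = (\<Sum>f\<in>A. \<Sum>g\<in>A. nb_walks n f (bar g))"
    by (simp add: nb_closed_def A_def)
  also have "\<dots> = (\<Sum>g\<in>A. nb_walks n (bar e) (bar g)) +
      (\<Sum>f\<in>A - {bar e}. \<Sum>g\<in>A. nb_walks n f (bar g))"
    using a by (intro sum.remove) auto
  also have "(\<Sum>g\<in>A. nb_walks n (bar e) (bar g)) = nb_walks (Suc n) (bar e) (bar e) + nb_walks n (bar e) e"
    using sum_closing_arc[of "bar e" "head X e" n] e by (simp add: A_def)
  \<comment> \<open>Rotating a cyclically reduced closed walk by one arc and reversing it exchanges e and bar e.\<close>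
  also have "nb_walks (Suc n) (bar e) (bar e) = nb_walks (Suc n) e e"
    using e by (intro nb_walks_reverse)
  also have "(\<Sum>f\<in>A - {bar e}. \<Sum>g\<in>A. nb_walks n f (bar g)) =
      (\<Sum>f\<in>A - {bar e}. nb_walks n f e + (\<Sum>g\<in>A - {bar e}. nb_walks n f (bar g)))"
  proof (intro sum.cong refl)
    fix f
    show "(\<Sum>g\<in>A. nb_walks n f (bar g)) = nb_walks n f e + (\<Sum>g\<in>A - {bar e}. nb_walks n f (bar g))"
      using sum.remove[OF a(2,1), of "\<lambda>g. nb_walks n f (bar g)"] by simp
  qed
  also have "\<dots> = nb_walks (Suc n) e e + (\<Sum>f\<in>A - {bar e}. \<Sum>g\<in>A - {bar e}. nb_walks n f (bar g))"
    by (simp add: sum.distrib A_def)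
  also have "(\<Sum>f\<in>A - {bar e}. \<Sum>g\<in>A - {bar e}. nb_walks n f (bar g)) =
      (\<Sum>f\<in>A - {bar e}. nb_walks (Suc n) f (bar e))"
  proof (intro sum.cong refl)
    fix f assume "f \<in> A - {bar e}"
    then have "f \<in> arcs X" by (auto simp: A_def)
    then show "(\<Sum>g\<in>A - {bar e}. nb_walks n f (bar g)) = nb_walks (Suc n) f (bar e)"
      using nb_walks_Suc_right[of f "bar e" n] e by (simp add: A_def)
  qed
  also have "\<dots> = nb_walks (Suc (Suc n)) e (bar e)"
    by (simp add: A_def)
  finally show ?thesis by simp
qed

text \<open>
  This is where homogeneity enters. In an infinite graph one cannot sum over all base points to
  compare tails \<open>e\<close>, \<open>bar e\<close> with tails \<open>bar e\<close>, \<open>e\<close>. However, in the recursion for the number of tailed walks every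
  term other than the recursive one is already symmetric under inversion of \<open>e\<close>, provided that
  the number of closed non-backtracking walks does not depend on the base point; so the
  symmetry propagates from lengths 1 and 2, for which there are no tailed walks.
\<close>

lemma tailed_bar:
  assumes const: "\<And>n x y. x \<in> verts X \<Longrightarrow> y \<in> verts X \<Longrightarrow> nb_closed n x = nb_closed n y"
    and "e \<in> arcs X"
  shows "nb_walks n (bar e) e = nb_walks n e (bar e)"
  using \<open>e \<in> arcs X\<close>
proof (induction n rule: induct_nat_012)
  case 0
  then show ?case by (auto dest: arev_neq)
next
  case 1
  then show ?case by (auto simp: sum.neutral)
next
  case (ge2 n)
  then have e: "e \<in> arcs X" by simp
  have "nb_walks (Suc (Suc n)) (bar e) (bar (bar e)) =
    nb_closed n (tail X e) - 2 * nb_walks (Suc n) (bar e) (bar e) - nb_walks n e (bar e)"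
    using tailed_rec[of "bar e" n] e by simp
  also have "nb_closed n (tail X e) = nb_closed n (head X e)"
    using e by (intro const) auto
  also have "nb_walks (Suc n) (bar e) (bar e) = nb_walks (Suc n) e e"
    using e by (intro nb_walks_reverse)
  also have "nb_walks n e (bar e) = nb_walks n (bar e) e"
    using ge2 by simp
  finally show ?case
    using tailed_rec[OF e, of n] by simp
qed

text \<open>
  Closed walks of length \<open>n + 1\<close> at \<open>x\<close> without backtracking and without tail, counted by their first arc \<open>e\<close>:
  appending a second copy of \<open>e\<close> gives exactly the walks of length \<open>n + 2\<close> from \<open>e\<close> to \<open>e\<close>.
\<close>

definition nb_cyclic :: "nat \<Rightarrow> 'a \<Rightarrow> real" where
  "nb_cyclic n x = (\<Sum>e\<in>out_arcs X x. nb_walks (Suc n) e e)"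

lemma nb_cyclic_0: "nb_cyclic 0 x = nb_closed 0 x"
  and nb_cyclic_1: "nb_cyclic (Suc 0) x = nb_closed (Suc 0) x"
proof -
  have z: "(\<Sum>e\<in>out_arcs X x. nb_walks 0 e (bar e)) = 0"
    "(\<Sum>e\<in>out_arcs X x. nb_walks (Suc 0) e (bar e)) = 0"
    by (auto intro!: sum.neutral dest!: arev_neq)
  show "nb_cyclic 0 x = nb_closed 0 x" "nb_cyclic (Suc 0) x = nb_closed (Suc 0) x"
    by (simp_all only: nb_cyclic_def nb_closed_eq z add_0_right)
qed

text \<open>
  With \<open>S n\<close> the number of tailed walks of length \<open>n + 1\<close>, summing the tail recursion over the \<open>q + 1\<close> arcs at \<open>x\<close> gives
  \<open>S (n + 2) = (q + 1) c n - 2 N n - S n\<close>, where \<open>c n = N n + S n\<close> splits the closed walks into reduced and tailed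
  ones.
\<close>

lemma nb_cyclic_rec:
  assumes const: "\<And>n x y. x \<in> verts X \<Longrightarrow> y \<in> verts X \<Longrightarrow> nb_closed n x = nb_closed n y"
    and x: "x \<in> verts X"
  shows "nb_cyclic (Suc (Suc n)) x = nb_closed (Suc (Suc n)) x - q * nb_closed n x + nb_cyclic n x"
proof -
  define S where "S n = (\<Sum>e\<in>out_arcs X x. nb_walks n e (bar e))" for n
  have cS: "nb_closed n x = nb_cyclic n x + S n" for n
    by (simp only: nb_closed_eq nb_cyclic_def S_def)
  have "S (Suc (Suc n)) =
      (\<Sum>e\<in>out_arcs X x. nb_closed n x - 2 * nb_walks (Suc n) e e - nb_walks n e (bar e))"
    unfolding S_def
  proof (intro sum.cong refl)
    fix e assume "e \<in> out_arcs X x"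
    then have e: "e \<in> arcs X" "head X e \<in> verts X" by auto
    show "nb_walks (Suc (Suc n)) e (bar e) = nb_closed n x - 2 * nb_walks (Suc n) e e - nb_walks n e (bar e)"
      using tailed_rec[OF e(1), of n] tailed_bar[OF const e(1), of n] const[OF e(2) x, of n] by linarith
  qed
  also have "\<dots> = (q + 1) * nb_closed n x - 2 * nb_cyclic n x - S n"
    using card_out_arcs[OF x]
    by (simp only: sum_subtractf sum_distrib_left[symmetric] S_def nb_cyclic_def sum_constant)
  also have "\<dots> = q * nb_closed n x - nb_cyclic n x"
    by (simp add: cS algebra_simps)
  finally show ?thesis
    using cS[of "Suc (Suc n)"] by simp
qed

section \<open>Independence of the base point\<close>

lemma nb_closed_automorphism:
  assumes "graph_automorphism X bar \<phi> \<psi>" and x: "x \<in> verts X"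
  shows "nb_closed n (\<phi> x) = nb_closed n x"
proof -
  have \<phi>: "bij_betw \<phi> (verts X) (verts X)" and \<psi>: "bij_betw \<psi> (arcs X) (arcs X)"
    and tail: "\<And>e. e \<in> arcs X \<Longrightarrow> tail X (\<psi> e) = \<phi> (tail X e)"
    and head: "\<And>e. e \<in> arcs X \<Longrightarrow> head X (\<psi> e) = \<phi> (head X e)"
    and bar: "\<And>e. e \<in> arcs X \<Longrightarrow> \<psi> (bar e) = bar (\<psi> e)"
    using assms(1) by (auto simp: graph_automorphism_def)
  have \<psi>_arcs: "e \<in> arcs X \<Longrightarrow> \<psi> e \<in> arcs X" for e
    using \<psi> by (auto simp: bij_betw_def)
  have inj: "\<psi> e = \<psi> f \<longleftrightarrow> e = f" if "e \<in> arcs X" "f \<in> arcs X" for e f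
    using \<psi> that by (auto simp: bij_betw_def inj_on_eq_iff)
  have out: "out_arcs X (\<phi> y) = \<psi> ` out_arcs X y" if y: "y \<in> verts X" for y
  proof (intro equalityI subsetI)
    fix f assume f: "f \<in> out_arcs X (\<phi> y)"
    then obtain e where e: "e \<in> arcs X" "f = \<psi> e"
      using \<psi> by (auto simp: bij_betw_def)
    then have "\<phi> (tail X e) = \<phi> y"
      using f tail by simp
    then have "tail X e = y"
      using \<phi> e y by (auto simp: bij_betw_def inj_on_eq_iff)
    then show "f \<in> \<psi> ` out_arcs X y"
      using e by auto
  qed (auto simp: \<psi>_arcs tail)
  have inj_out: "inj_on \<psi> (out_arcs X y - Z)" for y Z
    using inj by (auto simp: inj_on_def)
  have walks: "nb_walks n (\<psi> e) (\<psi> e') = nb_walks n e e'" if "e \<in> arcs X" "e' \<in> arcs X" for n e e'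
    using that
  proof (induction n arbitrary: e)
    case 0
    then show ?case by (simp add: inj)
  next
    case (Suc n)
    have "successors (\<psi> e) = \<psi> ` successors e"
      using Suc.prems inj by (auto simp: head out bar[symmetric])
    then have "nb_walks (Suc n) (\<psi> e) (\<psi> e') = (\<Sum>f\<in>successors e. nb_walks n (\<psi> f) (\<psi> e'))"
      by (simp add: sum.reindex[OF inj_out])
    also have "\<dots> = (\<Sum>f\<in>successors e. nb_walks n f e')"
      using Suc by (intro sum.cong) auto
    finally show ?case by simp
  qed
  have "nb_closed n (\<phi> x) = (\<Sum>e\<in>out_arcs X x. \<Sum>f\<in>out_arcs X x. nb_walks n (\<psi> e) (bar (\<psi> f)))"
    using inj_out[of x "{}"] by (simp add: nb_closed_def out[OF x] sum.reindex)
  also have "\<dots> = nb_closed n x"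
    unfolding nb_closed_def by (intro sum.cong refl) (auto simp: bar[symmetric] walks)
  finally show ?thesis .
qed

lemma nb_closed_const:
  assumes "vertex_transitive X bar" "x \<in> verts X" "y \<in> verts X"
  shows "nb_closed n x = nb_closed n y"
  using assms nb_closed_automorphism unfolding vertex_transitive_def by metis

section \<open>Counting closed geodesics\<close>

lemma finite_card_nb_walks:
  assumes "e \<in> arcs X"
  defines "P \<equiv> \<lambda>n e e'. {p. length p = Suc n \<and> hd p = e \<and> last p = e' \<and>
     successively (\<lambda>f g. g \<in> successors f) p}"
  shows "finite (P n e e') \<and> real (card (P n e e')) = nb_walks n e e'"
  using assms(1)
proof (induction n arbitrary: e)
  case 0
  have "P 0 e e' = (if e = e' then {[e]} else {})"
    by (auto simp: P_def length_Suc_conv)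
  then show ?case by simp
next
  case (Suc n)
  have eq: "P (Suc n) e e' = (\<Union>f\<in>successors e. (#) e ` P n f e')"
  proof (intro equalityI subsetI)
    fix p assume p: "p \<in> P (Suc n) e e'"
    then obtain f r where r: "p = e # f # r"
      by (auto simp: P_def length_Suc_conv)
    with p have "f # r \<in> P n f e'" "f \<in> successors e"
      by (auto simp: P_def)
    with r show "p \<in> (\<Union>f\<in>successors e. (#) e ` P n f e')"
      by blast
  qed (auto simp: P_def successively_Cons)
  have IH: "finite (P n f e')" "real (card (P n f e')) = nb_walks n f e'" if "f \<in> successors e" for f
    using Suc.IH[of f] that by auto
  have "card (P (Suc n) e e') = (\<Sum>f\<in>successors e. card ((#) e ` P n f e'))"
    unfolding eq by (intro card_UN_disjoint) (use IH in \<open>auto simp: P_def\<close>)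
  also have "\<dots> = (\<Sum>f\<in>successors e. card (P n f e'))"
    by (intro sum.cong refl card_image) auto
  finally have "real (card (P (Suc n) e e')) = (\<Sum>f\<in>successors e. real (card (P n f e')))"
    by simp
  also have "\<dots> = nb_walks (Suc n) e e'"
    using IH by simp
  finally show ?case
    unfolding eq using IH(1) by simp
qed

lemma cas_iff_successively:
  "p \<noteq> [] \<Longrightarrow> cas u p v \<longleftrightarrow>
     tail X (hd p) = u \<and> head X (last p) = v \<and> successively (\<lambda>e f. tail X f = head X e) p"
  by (induction p arbitrary: u rule: induct_list012) auto

text \<open>
  The absence of a tail and the closing condition together say that \<open>bar (last p)\<close> is an arc at \<open>x\<close> other than the
  first arc; this is the form in which the last-arc recursion for \<open>nb_walks\<close> applies.
\<close>

lemma closed_geodesic_iff: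
  assumes p: "p \<noteq> []" and x: "x \<in> verts X"
  shows "closed_geodesic X bar x p \<longleftrightarrow>
    hd p \<in> out_arcs X x \<and> bar (last p) \<in> out_arcs X x - {hd p} \<and>
    successively (\<lambda>e f. f \<in> successors e) p"
proof -
  have arcs: "successively (\<lambda>e f. f \<in> successors e) p \<and> hd p \<in> arcs X \<longleftrightarrow> set p \<subseteq> arcs X \<and>
      successively (\<lambda>e f. tail X f = head X e) p \<and> successively (\<lambda>e f. f \<noteq> bar e) p"
    using p by (induction p rule: induct_list012) auto
  have nb: "\<not> backtracking bar p \<longleftrightarrow> successively (\<lambda>e f. f \<noteq> bar e) p"
    by (auto simp: backtracking_def successively_conv_nth)
  have last: "last p \<in> arcs X" if "set p \<subseteq> arcs X"
    using that p by auto
  have bar: "bar (last p) \<in> arcs X \<longleftrightarrow> last p \<in> arcs X"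
    by (metis arev_arev arev_in_arcs)
  have hd: "hd p = bar (last p) \<longleftrightarrow> bar (last p) = hd p"
    by (rule eq_commute)
  have "closed_geodesic X bar x p \<longleftrightarrow>
      (set p \<subseteq> arcs X \<and> successively (\<lambda>e f. tail X f = head X e) p \<and>
        successively (\<lambda>e f. f \<noteq> bar e) p) \<and>
      tail X (hd p) = x \<and> head X (last p) = x \<and> bar (last p) \<noteq> hd p"
    unfolding closed_geodesic_def nb has_tail_def awalk_def cas_iff_successively[OF p] hd
    using p x by blast
  also have "\<dots> \<longleftrightarrow> hd p \<in> out_arcs X x \<and> bar (last p) \<in> out_arcs X x - {hd p} \<and>
      successively (\<lambda>e f. f \<in> successors e) p"
    unfolding arcs[symmetric]
  proof (cases "last p \<in> arcs X")
    case True
    then show "(successively (\<lambda>e f. f \<in> successors e) p \<and> hd p \<in> arcs X) \<and>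
        tail X (hd p) = x \<and> head X (last p) = x \<and> bar (last p) \<noteq> hd p \<longleftrightarrow>
        hd p \<in> out_arcs X x \<and> bar (last p) \<in> out_arcs X x - {hd p} \<and>
        successively (\<lambda>e f. f \<in> successors e) p"
      by (simp only: in_out_arcs_conv Diff_iff singleton_iff tail_arev arev_in_arcs) blast
  next
    case False
    then show "(successively (\<lambda>e f. f \<in> successors e) p \<and> hd p \<in> arcs X) \<and>
        tail X (hd p) = x \<and> head X (last p) = x \<and> bar (last p) \<noteq> hd p \<longleftrightarrow>
        hd p \<in> out_arcs X x \<and> bar (last p) \<in> out_arcs X x - {hd p} \<and>
        successively (\<lambda>e f. f \<in> successors e) p"
      using arcs last bar by (simp only: in_out_arcs_conv Diff_iff singleton_iff) blast
  qed
  finally show ?thesis .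
qed

lemma num_closed_geodesics_eq:
  assumes x: "x \<in> verts X"
  shows "real (num_closed_geodesics X bar x (Suc n)) = nb_cyclic n x"
proof -
  define P where "P = (\<lambda>n e e'. {p. length p = Suc n \<and> hd p = e \<and> last p = e' \<and>
     successively (\<lambda>f g. g \<in> successors f) p})"
  define I where "I = Sigma (out_arcs X x) (\<lambda>e. out_arcs X x - {e})"
  have P: "finite (P n e e')" "real (card (P n e e')) = nb_walks n e e'" if "e \<in> arcs X" for e e' n
    using finite_card_nb_walks[OF that] unfolding P_def by auto
  have eq: "{p. closed_geodesic X bar x p \<and> length p = Suc n} =
      (\<Union>(e, f)\<in>I. P n e (bar f))"
  proof (intro equalityI subsetI)
    fix p assume "p \<in> {p. closed_geodesic X bar x p \<and> length p = Suc n}"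
    then have p: "closed_geodesic X bar x p" "length p = Suc n" "p \<noteq> []" by auto
    then have "(hd p, bar (last p)) \<in> I" "p \<in> P n (hd p) (bar (bar (last p)))"
      using closed_geodesic_iff[OF p(3) x] by (auto simp: I_def P_def)
    then show "p \<in> (\<Union>(e, f)\<in>I. P n e (bar f))" by blast
  next
    fix p assume "p \<in> (\<Union>(e, f)\<in>I. P n e (bar f))"
    then obtain e f where ef: "(e, f) \<in> I" "p \<in> P n e (bar f)" by auto
    then have "p \<noteq> []" by (auto simp: P_def)
    then show "p \<in> {p. closed_geodesic X bar x p \<and> length p = Suc n}"
      using closed_geodesic_iff[OF _ x, of p] ef by (auto simp: I_def P_def)
  qed
  have "real (num_closed_geodesics X bar x (Suc n)) = (\<Sum>i\<in>I. real (card (case i of (e, f) \<Rightarrow> P n e (bar f))))"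
    unfolding num_closed_geodesics_def eq
  proof (subst card_UN_disjoint)
    show "finite I" by (auto simp: I_def)
    show "\<forall>i\<in>I. finite (case i of (e, f) \<Rightarrow> P n e (bar f))"
      using P by (auto simp: I_def)
    show "\<forall>i\<in>I. \<forall>j\<in>I. i \<noteq> j \<longrightarrow> (case i of (e, f) \<Rightarrow> P n e (bar f)) \<inter> (case j of (e, f) \<Rightarrow> P n e (bar f)) = {}"
      by (auto simp: P_def arev_eq_iff)
  qed simp
  also have "\<dots> = (\<Sum>(e, f)\<in>I. nb_walks n e (bar f))"
    by (intro sum.cong) (auto simp: I_def P)
  also have "\<dots> = (\<Sum>e\<in>out_arcs X x. \<Sum>f\<in>out_arcs X x - {e}. nb_walks n e (bar f))"
    unfolding I_def by (subst sum.Sigma) auto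
  also have "\<dots> = nb_cyclic n x"
    unfolding nb_cyclic_def
  proof (intro sum.cong refl)
    fix e assume "e \<in> out_arcs X x"
    then show "(\<Sum>f\<in>out_arcs X x - {e}. nb_walks n e (bar f)) = nb_walks (Suc n) e e"
      using nb_walks_Suc_right[of e e n] by simp
  qed
  finally show ?thesis .
qed

section \<open>Non-backtracking walks and the adjacency operator\<close>

definition adjacency :: "('a \<Rightarrow> real) \<Rightarrow> 'a \<Rightarrow> real" where
  "adjacency f x = (\<Sum>e\<in>out_arcs X x. f (head X e))"

text \<open>
  As for \<open>nb_walks\<close>, the index \<open>n\<close> stands for walks of length \<open>n + 1\<close>.
\<close>

definition nb_from :: "nat \<Rightarrow> 'b \<Rightarrow> 'a \<Rightarrow> real" where
  "nb_from n e y = (\<Sum>f\<in>out_arcs X y. nb_walks n e (bar f))"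

definition nb_between :: "nat \<Rightarrow> 'a \<Rightarrow> 'a \<Rightarrow> real" where
  "nb_between n x y = (\<Sum>e\<in>out_arcs X x. nb_from n e y)"

lemma nb_between_same: "nb_between n x x = nb_closed n x"
  by (simp add: nb_between_def nb_from_def nb_closed_def)

lemma nb_from_0: "e \<in> arcs X \<Longrightarrow> nb_from 0 e y = of_bool (head X e = y)"
proof -
  assume e: "e \<in> arcs X"
  have "(e = bar f) = (f = bar e)" for f by auto
  then have "nb_from 0 e y = of_bool (bar e \<in> out_arcs X y)"
    by (simp add: nb_from_def of_bool_def sum.delta)
  with e show ?thesis by simp
qed

text \<open>
  A walk starting at \<open>head X e\<close> either can be prolonged backwards by \<open>e\<close> or starts with \<open>bar e\<close>. This single
  observation yields the three-term recursion for non-backtracking walks below.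
\<close>

lemma nb_between_head:
  assumes e: "e \<in> arcs X"
  shows "nb_between n (head X e) y = nb_from (Suc n) e y + nb_from n (bar e) y"
proof -
  have "nb_between n (head X e) y = nb_from n (bar e) y + (\<Sum>g\<in>successors e. nb_from n g y)"
    unfolding nb_between_def using e by (intro sum.remove) auto
  also have "(\<Sum>g\<in>successors e. nb_from n g y) = nb_from (Suc n) e y"
    unfolding nb_from_def by (subst sum.swap) simp
  finally show ?thesis by simp
qed

lemma nb_between_0:
  "nb_between 0 x y = adjacency (\<lambda>v. of_bool (v = y)) x"
  by (auto simp: nb_between_def adjacency_def nb_from_0 intro!: sum.cong)

lemma adjacency_nb_between:
  "adjacency (\<lambda>v. nb_between n v y) x =
     nb_between (Suc n) x y + (\<Sum>e\<in>out_arcs X x. nb_from n (bar e) y)"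
proof -
  have "adjacency (\<lambda>v. nb_between n v y) x =
      (\<Sum>e\<in>out_arcs X x. nb_from (Suc n) e y + nb_from n (bar e) y)"
    unfolding adjacency_def by (intro sum.cong refl nb_between_head) simp
  then show ?thesis
    by (simp add: sum.distrib nb_between_def)
qed

text \<open>
  The constant \<open>q + 1\<close>, instead of \<open>q\<close>, counts the backtracking walks of length two: all \<open>q + 1\<close> arcs
  at \<open>x\<close> can be followed by their inverse.
\<close>

lemma nb_between_1:
  assumes x: "x \<in> verts X"
  shows "nb_between (Suc 0) x y = adjacency (\<lambda>v. nb_between 0 v y) x - (q + 1) * of_bool (x = y)"
proof -
  have "(\<Sum>e\<in>out_arcs X x. nb_from 0 (bar e) y) = (\<Sum>e\<in>out_arcs X x. of_bool (x = y))"
    by (intro sum.cong refl) (auto simp: nb_from_0)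
  then show ?thesis
    using card_out_arcs[OF x] by (simp add: adjacency_nb_between)
qed

text \<open>
  The correction term counts walks that start with \<open>e\<close>, \<open>bar e\<close> and do not backtrack later; the remainder is a
  non-backtracking walk from \<open>x\<close> that does not start with \<open>e\<close>, and each nonempty walk from \<open>x\<close> admits \<open>q\<close> such
  arcs \<open>e\<close>.
\<close>

lemma nb_between_rec:
  assumes x: "x \<in> verts X"
  shows "nb_between (Suc (Suc n)) x y =
    adjacency (\<lambda>v. nb_between (Suc n) v y) x - q * nb_between n x y"
proof -
  have "(\<Sum>e\<in>out_arcs X x. nb_from (Suc n) (bar e) y) =
      (\<Sum>e\<in>out_arcs X x. nb_between n x y - nb_from n e y)"
  proof (intro sum.cong refl)
    fix e assume "e \<in> out_arcs X x"
    then show "nb_from (Suc n) (bar e) y = nb_between n x y - nb_from n e y"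
      using nb_between_head[of "bar e" n y] by simp
  qed
  also have "\<dots> = q * nb_between n x y"
    using card_out_arcs[OF x]
    by (simp add: sum_subtractf nb_between_def[symmetric] algebra_simps)
  finally show ?thesis
    by (simp add: adjacency_nb_between)
qed

end

section \<open>Measures with a bounded, smooth Laplace transform\<close>

lemma AE_le_if_strict_superlevels_null:
  fixes f :: "'c \<Rightarrow> real"
  assumes "finite_measure M" and f [measurable]: "f \<in> borel_measurable M"
    and null: "\<And>\<epsilon>. \<epsilon> > 0 \<Longrightarrow> measure M {l \<in> space M. c + \<epsilon> \<le> f l} = 0"
  shows "AE l in M. f l \<le> c"
proof -
  interpret finite_measure M by fact
  have "AE l in M. \<forall>n::nat. \<not> c + 1 / Suc n \<le> f l"
    unfolding AE_all_countable
  proof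
    fix n :: nat
    have "{l \<in> space M. c + 1 / Suc n \<le> f l} \<in> null_sets M"
      using null[of "1 / Suc n"] by (auto simp: null_sets_def emeasure_eq_measure)
    from AE_not_in[OF this] AE_space show "AE l in M. \<not> c + 1 / Suc n \<le> f l"
      by eventually_elim simp
  qed
  then show ?thesis
  proof eventually_elim
    case (elim l)
    show "f l \<le> c"
    proof (rule ccontr)
      assume "\<not> f l \<le> c"
      then obtain n where "1 / Suc n < f l - c"
        using reals_Archimedean[of "f l - c"] by (auto simp: inverse_eq_divide)
      then have "c + 1 / Suc n \<le> f l" by linarith
      with elim show False by blast
    qed
  qed
qed

text \<open>
  A sequence of Markov inequalities, one for each test function \<open>f n\<close>; used with exponentials to bound the support
  from below and with powers to bound it from above.
\<close>

lemma measure_eq_0_by_Markov: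
  fixes f :: "nat \<Rightarrow> 'c \<Rightarrow> real"
  assumes "finite_measure M"
    and f: "\<And>n. integrable M (f n)" "\<And>n. AE l in M. 0 \<le> f n l"
    and S: "\<And>n l. l \<in> S \<Longrightarrow> c n \<le> f n l" "S \<in> sets M"
    and c: "\<And>n. c n > 0" "(\<lambda>n. (\<integral>l. f n l \<partial>M) / c n) \<longlonglongrightarrow> 0"
  shows "measure M S = 0"
proof -
  interpret finite_measure M by fact
  have "measure M S \<le> (\<integral>l. f n l \<partial>M) / c n" for n
  proof -
    have "measure M S \<le> measure M {l \<in> space M. c n \<le> f n l}"
      using S sets.sets_into_space[OF S(2)] f(1)[of n] by (intro finite_measure_mono) auto
    also have "\<dots> \<le> (\<integral>l. f n l \<partial>M) / c n"
      by (rule integral_Markov_inequality_measure[of M "f n" "{}"]) (use f c in auto)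
    finally show ?thesis .
  qed
  then have "measure M S \<le> 0"
    by (intro LIMSEQ_le_const[OF c(2)]) auto
  then show ?thesis
    by (simp add: measure_le_0_iff)
qed

text \<open>
  Mass at \<open>l < 0\<close> would make the Laplace transform grow exponentially.
\<close>

lemma AE_nonneg_of_bounded_Laplace:
  assumes M: "sets M = sets borel"
    and G: "\<And>t. t \<ge> 0 \<Longrightarrow> has_bochner_integral M (\<lambda>l. exp (- l * t)) (G t)"
    and B: "\<And>t. t \<ge> 0 \<Longrightarrow> \<bar>G t\<bar> \<le> B"
  shows "finite_measure M" "AE l in M. (0::real) \<le> l"
proof -
  have "integrable M (\<lambda>_. 1 :: real)"
    using G[of 0] by (simp add: has_bochner_integral_iff)
  then show fin: "finite_measure M"
    by (intro finite_measureI) (simp add: integrable_iff_bounded less_top)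
  have [measurable_cong]: "sets M = sets borel" by fact
  have "AE l in M. - l \<le> 0"
  proof (rule AE_le_if_strict_superlevels_null[OF fin])
    fix \<epsilon> :: real assume \<epsilon>: "\<epsilon> > 0"
    show "measure M {l \<in> space M. 0 + \<epsilon> \<le> - l} = 0"
    proof (rule measure_eq_0_by_Markov[OF fin])
      show "integrable M (\<lambda>l. exp (- l * real k))" for k :: nat
        using G[of "real k"] by (simp add: has_bochner_integral_iff)
      show "exp (\<epsilon> * real k) \<le> exp (- l * real k)" if "l \<in> {l \<in> space M. 0 + \<epsilon> \<le> - l}" for k l
        using that mult_right_mono[of \<epsilon> "- l" "real k"] by simp
      show "(\<lambda>k. (\<integral>l. exp (- l * real k) \<partial>M) / exp (\<epsilon> * real k)) \<longlonglongrightarrow> 0"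
      proof (rule tendsto_0_le[where K = B and f = "\<lambda>k. exp (- \<epsilon>) ^ k"])
        show "(\<lambda>k. exp (- \<epsilon>) ^ k) \<longlonglongrightarrow> 0"
          using \<epsilon> by (intro LIMSEQ_realpow_zero) auto
        have "norm ((\<integral>l. exp (- l * real k) \<partial>M) / exp (\<epsilon> * real k)) \<le> norm (exp (- \<epsilon>) ^ k) * B" for k
        proof -
          have "exp (- \<epsilon>) ^ k = 1 / exp (\<epsilon> * real k)"
            by (simp add: exp_of_nat_mult[symmetric] exp_minus divide_inverse mult.commute power_inverse)
          then show ?thesis
            using B[of "real k"] has_bochner_integral_integral_eq[OF G[of "real k"]]
            by (simp add: divide_right_mono)
        qed
        then show "\<forall>\<^sub>F k in sequentially. norm ((\<integral>l. exp (- l * real k) \<partial>M) / exp (\<epsilon> * real k))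
            \<le> norm (exp (- \<epsilon>) ^ k) * B" by simp
      qed
    qed auto
  qed simp
  then show "AE l in M. 0 \<le> l" by simp
qed

text \<open>
  The quotients increase to the derivative because \<open>1 - exp (- l h)\<close> is concave in \<open>h\<close>. Along dyadic steps
  this is the elementary inequality \<open>1 - w\<^sup>2 \<le> 2 (1 - w)\<close>, valid for both signs of \<open>l\<close>.
\<close>

lemma dyadic_difference_quotient:
  fixes l :: real
  shows "mono (\<lambda>k. (1 - exp (- l * (1 / 2 ^ k))) / (1 / 2 ^ k))"
    and "(\<lambda>k. (1 - exp (- l * (1 / 2 ^ k))) / (1 / 2 ^ k)) \<longlonglongrightarrow> l"
proof -
  show "mono (\<lambda>k. (1 - exp (- l * (1 / 2 ^ k))) / (1 / 2 ^ k))"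
    unfolding mono_iff_le_Suc
  proof
    fix k :: nat
    define w where "w = exp (- l * (1 / 2 ^ Suc k))"
    have w: "exp (- l * (1 / 2 ^ k)) = w * w"
      unfolding w_def by (simp add: exp_add[symmetric] field_simps)
    have "(1 - w * w) * 2 ^ k = (1 - w) * 2 ^ Suc k - (1 - w)\<^sup>2 * 2 ^ k"
      by (simp add: power2_eq_square algebra_simps)
    also have "\<dots> \<le> (1 - w) * 2 ^ Suc k" by simp
    finally show "(1 - exp (- l * (1 / 2 ^ k))) / (1 / 2 ^ k)
        \<le> (1 - exp (- l * (1 / 2 ^ Suc k))) / (1 / 2 ^ Suc k)"
      unfolding w w_def[symmetric] by simp
  qed
  have lim: "filterlim (\<lambda>k. 1 / 2 ^ k :: real) (at 0) sequentially"
  proof (rule filterlim_atI)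
    have "(\<lambda>k. (1 / 2 :: real) ^ k) \<longlonglongrightarrow> 0" by (rule LIMSEQ_realpow_zero) auto
    then show "(\<lambda>k. 1 / 2 ^ k :: real) \<longlonglongrightarrow> 0" by (simp add: power_divide)
  qed simp
  have "((\<lambda>h. 1 - exp (- l * h)) has_real_derivative l) (at 0)"
    by (auto intro!: derivative_eq_intros)
  then have "((\<lambda>h. (1 - exp (- l * h)) / h) \<longlongrightarrow> l) (at 0)"
    by (simp add: has_field_derivative_iff)
  from filterlim_compose[OF this lim]
  show "(\<lambda>k. (1 - exp (- l * (1 / 2 ^ k))) / (1 / 2 ^ k)) \<longlonglongrightarrow> l" .
qed

text \<open>
  Differentiation under the integral sign at a boundary point, where no dominating function is
  known beforehand: the difference quotients of \<open>exp (- l t)\<close> are monotone in the step on \<open>l \<ge> 0\<close>, so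
  monotone convergence yields the integrability of the next moment together with its value.
\<close>

lemma moments_of_Laplace_derivatives:
  assumes M: "sets M = sets borel"
    and nonneg: "AE l in M. 0 \<le> l"
    and G0: "\<And>t. t \<ge> 0 \<Longrightarrow> has_bochner_integral M (\<lambda>l. exp (- l * t)) (G 0 t)"
    and deriv: "\<And>j t. t \<ge> 0 \<Longrightarrow> (G j has_real_derivative - G (Suc j) t) (at t within {0..})"
    and t: "t \<ge> 0"
  shows "has_bochner_integral M (\<lambda>l. l ^ j * exp (- l * t)) (G j t)"
  using t
proof (induction j arbitrary: t)
  case 0
  then show ?case using G0 by simp
next
  case (Suc j)
  have [measurable_cong]: "sets M = sets borel" by fact
  define h :: "nat \<Rightarrow> real" where "h = (\<lambda>k. 1 / 2 ^ k)"
  have h: "h k > 0" for k by (simp add: h_def)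
  define u where "u = (\<lambda>k l. l ^ j * exp (- l * t) * ((1 - exp (- l * h k)) / h k))"
  have u: "has_bochner_integral M (u k) ((G j t - G j (t + h k)) / h k)" for k
  proof -
    have "has_bochner_integral M (\<lambda>l. (l ^ j * exp (- l * t) - l ^ j * exp (- l * (t + h k))) / h k)
        ((G j t - G j (t + h k)) / h k)"
      using Suc h[of k]
      by (intro has_bochner_integral_divide_zero has_bochner_integral_diff Suc.IH) auto
    also have "(\<lambda>l. (l ^ j * exp (- l * t) - l ^ j * exp (- l * (t + h k))) / h k) = u k"
      by (auto simp: u_def fun_eq_iff distrib_left exp_diff field_simps exp_minus exp_add)
    finally show ?thesis .
  qed
  have ui: "integrable M (u k)" "integral\<^sup>L M (u k) = (G j t - G j (t + h k)) / h k" for k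
    using u[of k] by (auto simp: has_bochner_integral_iff)
  have lim: "(\<lambda>k. integral\<^sup>L M (u k)) \<longlonglongrightarrow> G (Suc j) t"
  proof -
    have "((\<lambda>s. (G j s - G j t) / (s - t)) \<longlongrightarrow> - G (Suc j) t) (at t within {0..})"
      using deriv[OF Suc.prems, of j] by (simp add: has_field_derivative_iff)
    moreover have "filterlim (\<lambda>k. t + h k) (at t within {0..}) sequentially"
      unfolding filterlim_at
    proof
      have "(\<lambda>k. (1 / 2 :: real) ^ k) \<longlonglongrightarrow> 0" by (rule LIMSEQ_realpow_zero) auto
      then have "h \<longlonglongrightarrow> 0" by (simp add: power_divide h_def)
      from tendsto_add[OF tendsto_const this, of t] show "(\<lambda>k. t + h k) \<longlonglongrightarrow> t" by simp
      show "\<forall>\<^sub>F k in sequentially. t + h k \<in> {0..} \<and> t + h k \<noteq> t"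
        using h Suc.prems by (auto intro!: always_eventually simp: less_imp_neq[symmetric] add_nonneg_nonneg less_imp_le)
    qed
    ultimately have "(\<lambda>k. (G j (t + h k) - G j t) / (t + h k - t)) \<longlonglongrightarrow> - G (Suc j) t"
      by (rule filterlim_compose)
    from tendsto_minus[OF this] show ?thesis
      by (simp add: ui minus_divide_left)
  qed
  have mono: "AE l in M. mono (\<lambda>k. u k l)"
    using nonneg
  proof eventually_elim
    case (elim l)
    then have "0 \<le> l ^ j * exp (- l * t)" by simp
    with dyadic_difference_quotient(1)[of l] show ?case
      unfolding u_def h_def mono_def by (auto intro!: mult_left_mono)
  qed
  have limit: "AE l in M. (\<lambda>k. u k l) \<longlonglongrightarrow> l ^ Suc j * exp (- l * t)"
  proof (rule AE_I2)
    fix l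
    show "(\<lambda>k. u k l) \<longlonglongrightarrow> l ^ Suc j * exp (- l * t)"
      using tendsto_mult_left[OF dyadic_difference_quotient(2)[of l], of "l ^ j * exp (- l * t)"]
      unfolding u_def h_def by (simp add: algebra_simps)
  qed
  have "(\<lambda>l. l ^ Suc j * exp (- l * t)) \<in> borel_measurable M"
    by measurable
  from has_bochner_integral_monotone_convergence[OF ui(1) mono limit lim this]
  show ?case .
qed

text \<open>
  Mass beyond \<open>R > C\<close> would contribute at least a multiple of \<open>R ^ j\<close> to the \<open>j\<close>-th moment.
\<close>

lemma AE_le_of_moment_growth:
  assumes M: "sets M = sets borel" "finite_measure M"
    and nonneg: "AE l in M. 0 \<le> l"
    and mom: "\<And>j. has_bochner_integral M (\<lambda>l. l ^ j) (m j)"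
    and growth: "\<And>j. \<bar>m j\<bar> \<le> B * C ^ j" and C: "C > 0"
  shows "AE l in M. l \<le> (C::real)"
proof (rule AE_le_if_strict_superlevels_null[OF M(2)])
  have [measurable_cong]: "sets M = sets borel" by fact
  show "(\<lambda>l. l) \<in> borel_measurable M" by measurable
  fix \<epsilon> :: real assume \<epsilon>: "\<epsilon> > 0"
  define R where "R = C + \<epsilon>"
  have R: "R > C" "R > 0" using C \<epsilon> by (auto simp: R_def)
  show "measure M {l \<in> space M. C + \<epsilon> \<le> l} = 0"
    unfolding R_def[symmetric]
  proof (rule measure_eq_0_by_Markov[OF M(2)])
    show "integrable M (\<lambda>l. l ^ j)" for j
      using mom by (auto simp: has_bochner_integral_iff)
    show "AE l in M. 0 \<le> l ^ j" for j
      using nonneg by eventually_elim simp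
    show "R ^ j \<le> l ^ j" if "l \<in> {l \<in> space M. R \<le> l}" for j l
      using that R by (auto intro!: power_mono)
    show "(\<lambda>j. (\<integral>l. l ^ j \<partial>M) / R ^ j) \<longlonglongrightarrow> 0"
    proof (rule tendsto_0_le[where K = B and f = "\<lambda>j. (C / R) ^ j"])
      show "(\<lambda>j. (C / R) ^ j) \<longlonglongrightarrow> 0"
        using R C by (intro LIMSEQ_realpow_zero) auto
      have "norm ((\<integral>l. l ^ j \<partial>M) / R ^ j) \<le> norm ((C / R) ^ j) * B" for j
        using growth[of j] has_bochner_integral_integral_eq[OF mom[of j]] R C
        by (simp add: power_divide divide_right_mono mult.commute)
      then show "\<forall>\<^sub>F j in sequentially. norm ((\<integral>l. l ^ j \<partial>M) / R ^ j) \<le> norm ((C / R) ^ j) * B"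
        by simp
    qed
  qed (use R in auto)
qed

section \<open>Spectral representation of polynomials in the Laplacian\<close>

context regular_bidirected
begin

lemma iterated_laplacian_cong:
  assumes "\<And>y. y \<in> verts X \<Longrightarrow> f y = g y" and "x \<in> verts X"
  shows "(laplacian X q ^^ j) f x = (laplacian X q ^^ j) g x"
  using assms(2)
proof (induction j arbitrary: x)
  case (Suc j)
  have "(laplacian X q ^^ j) f (head X e) = (laplacian X q ^^ j) g (head X e)"
    if "e \<in> out_arcs X x" for e
    using that by (intro Suc.IH) auto
  then have "(\<Sum>e\<in>out_arcs X x. (laplacian X q ^^ j) f (head X e)) =
      (\<Sum>e\<in>out_arcs X x. (laplacian X q ^^ j) g (head X e))"
    by (intro sum.cong refl)
  with Suc show ?case by (simp add: laplacian_def)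
qed (use assms(1) in simp)

lemma iterated_laplacian_linear:
  "(laplacian X q ^^ j) (\<lambda>x. a * f x + b * g x) =
    (\<lambda>x. a * (laplacian X q ^^ j) f x + b * (laplacian X q ^^ j) g x)"
  by (induction j)
    (auto simp: laplacian_def fun_eq_iff sum.distrib sum_distrib_left[symmetric] algebra_simps)

lemma iterated_laplacian_bound:
  assumes "\<And>y. y \<in> verts X \<Longrightarrow> \<bar>f y\<bar> \<le> B" and "x \<in> verts X"
  shows "\<bar>(laplacian X q ^^ j) f x\<bar> \<le> B * (2 * (real q + 1)) ^ j"
  using assms(2)
proof (induction j arbitrary: x)
  case (Suc j)
  define D where "D = B * (2 * (real q + 1)) ^ j"
  define g where "g = (laplacian X q ^^ j) f"
  have g: "\<bar>g y\<bar> \<le> D" if "y \<in> verts X" for y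
    using Suc.IH[OF that] by (simp add: g_def D_def)
  have "\<bar>laplacian X q g x\<bar> \<le> \<bar>(real q + 1) * g x\<bar> + \<bar>\<Sum>e\<in>out_arcs X x. g (head X e)\<bar>"
    unfolding laplacian_def by (rule abs_triangle_ineq4)
  also have "\<bar>(real q + 1) * g x\<bar> \<le> (real q + 1) * D"
    using g[OF Suc.prems] by (simp add: abs_mult mult_left_mono)
  also have "\<bar>\<Sum>e\<in>out_arcs X x. g (head X e)\<bar> \<le> (\<Sum>e\<in>out_arcs X x. \<bar>g (head X e)\<bar>)"
    by (rule sum_abs)
  also have "\<dots> \<le> of_nat (card (out_arcs X x)) * D"
    by (intro sum_bounded_above g) auto
  also have "\<dots> = (real q + 1) * D"
    using card_out_arcs[OF Suc.prems] by simp
  finally show ?case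
    by (simp add: g_def D_def algebra_simps)
qed (use assms(1) in simp)

text \<open>
  The Laplacian involves finite sums only, so it commutes with the time derivative, and the heat
  equation may be differentiated repeatedly.
\<close>

lemma heat_kernel_derivative:
  assumes K: "is_heat_kernel X q x0 K" and "x \<in> verts X" "t \<ge> 0"
  shows "((\<lambda>s. (laplacian X q ^^ j) (K s) x) has_real_derivative
           - (laplacian X q ^^ Suc j) (K t) x) (at t within {0..})"
  using \<open>x \<in> verts X\<close>
proof (induction j arbitrary: x)
  case 0
  then obtain D where "((\<lambda>s. K s x) has_real_derivative D) (at t within {0..})"
    "laplacian X q (K t) x + D = 0"
    using K \<open>t \<ge> 0\<close> unfolding is_heat_kernel_def by blast
  moreover from this(2) have "D = - laplacian X q (K t) x" by simp
  ultimately show ?case by simp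
next
  case (Suc j)
  have step: "(laplacian X q ^^ Suc i) f x = (real q + 1) * (laplacian X q ^^ i) f x
      - (\<Sum>e\<in>out_arcs X x. (laplacian X q ^^ i) f (head X e))" for i f
    by (simp add: laplacian_def)
  define D where "D = (laplacian X q ^^ Suc j) (K t)"
  have "((\<lambda>s. (laplacian X q ^^ Suc j) (K s) x) has_real_derivative
        (real q + 1) * (- D x) - (\<Sum>e\<in>out_arcs X x. - D (head X e))) (at t within {0..})"
    unfolding step[of j]
    by (intro DERIV_diff DERIV_cmult DERIV_sum Suc.IH[folded D_def] Suc.prems) auto
  also have "(real q + 1) * (- D x) - (\<Sum>e\<in>out_arcs X x. - D (head X e)) =
      - (laplacian X q ^^ Suc (Suc j)) (K t) x"
    unfolding step[of "Suc j"] D_def sum_negf by linarith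
  finally show ?case .
qed

text \<open>
  The function \<open>f\<close> plays the role of \<open>p(\<Delta>)\<close> applied to the point mass at \<open>x0\<close>. All moments of \<open>p\<close>, and not only
  its integral, are recorded so that the relation is preserved when \<open>\<Delta>\<close> is applied to \<open>f\<close>.
\<close>

definition represents :: "real measure \<Rightarrow> 'a \<Rightarrow> (real \<Rightarrow> real) \<Rightarrow> ('a \<Rightarrow> real) \<Rightarrow> bool" where
  "represents \<mu> x0 p f \<longleftrightarrow>
     (\<forall>j. has_bochner_integral \<mu> (\<lambda>l. l ^ j * p l) ((laplacian X q ^^ j) f x0))"

lemma representsD:
  "represents \<mu> x0 p f \<Longrightarrow> has_bochner_integral \<mu> p (f x0)"
  unfolding represents_def by (drule spec[of _ 0]) simp

lemma represents_cong:
  assumes "represents \<mu> x0 p f" "x0 \<in> verts X" "\<And>x. x \<in> verts X \<Longrightarrow> f x = g x"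
  shows "represents \<mu> x0 p g"
  using assms iterated_laplacian_cong[of f g x0] by (auto simp: represents_def)

lemma represents_linear:
  assumes "represents \<mu> x0 p f" "represents \<mu> x0 r g"
  shows "represents \<mu> x0 (\<lambda>l. a * p l + b * r l) (\<lambda>x. a * f x + b * g x)"
  unfolding represents_def iterated_laplacian_linear
proof
  fix j
  have "has_bochner_integral \<mu> (\<lambda>l. a * (l ^ j * p l) + b * (l ^ j * r l))
      (a * (laplacian X q ^^ j) f x0 + b * (laplacian X q ^^ j) g x0)"
    using assms unfolding represents_def
    by (intro has_bochner_integral_add has_bochner_integral_mult_right) auto
  then show "has_bochner_integral \<mu> (\<lambda>l. l ^ j * (a * p l + b * r l))
      (a * (laplacian X q ^^ j) f x0 + b * (laplacian X q ^^ j) g x0)"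
    by (simp add: algebra_simps)
qed

lemma represents_laplacian:
  assumes "represents \<mu> x0 p f"
  shows "represents \<mu> x0 (\<lambda>l. l * p l) (laplacian X q f)"
  unfolding represents_def
proof
  fix j
  have "has_bochner_integral \<mu> (\<lambda>l. l ^ Suc j * p l) ((laplacian X q ^^ Suc j) f x0)"
    using assms unfolding represents_def by blast
  then show "has_bochner_integral \<mu> (\<lambda>l. l ^ j * (l * p l)) ((laplacian X q ^^ j) (laplacian X q f) x0)"
    by (simp add: funpow_swap1 algebra_simps)
qed

lemma represents_adjacency:
  assumes "represents \<mu> x0 p f"
  shows "represents \<mu> x0 (\<lambda>l. (real q + 1 - l) * p l) (adjacency f)"
proof -
  have "(\<lambda>l. (real q + 1) * p l + (- 1) * (l * p l)) = (\<lambda>l. (real q + 1 - l) * p l)"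
    "(\<lambda>x. (real q + 1) * f x + (- 1) * laplacian X q f x) = adjacency f"
    by (auto simp: algebra_simps laplacian_def adjacency_def)
  with represents_linear[OF assms represents_laplacian[OF assms], of "real q + 1" "- 1"]
  show ?thesis by simp
qed

text \<open>
  The heat kernel is bounded, so the spectral measure lives on \<open>l \<ge> 0\<close>; its time derivatives at \<open>0\<close> are iterated Laplacians of the point mass, which gives
  all moments; and since the Laplacian is bounded by \<open>2 (q + 1)\<close> in the supremum norm, these moments grow slowly
  enough to confine the measure to \<open>l \<le> 2 (q + 1)\<close>.
\<close>

lemma spectral_measure_properties:
  assumes \<mu>: "is_spectral_measure X q x0 \<mu>" and x0: "x0 \<in> verts X"
  shows "finite_measure \<mu>" "measure \<mu> (space \<mu>) = 1" "AE l in \<mu>. \<bar>real q + 1 - l\<bar> \<le> real q + 1"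
    "represents \<mu> x0 (\<lambda>_. 1) (\<lambda>x. of_bool (x = x0))"
proof -
  from \<mu> obtain K where sets: "sets \<mu> = sets borel" and K: "is_heat_kernel X q x0 K"
    and int: "\<And>t. t \<ge> 0 \<Longrightarrow> has_bochner_integral \<mu> (\<lambda>l. exp (- l * t)) (K t x0)"
    unfolding is_spectral_measure_def by blast
  from K obtain B where B: "\<And>t x. t \<ge> 0 \<Longrightarrow> x \<in> verts X \<Longrightarrow> \<bar>K t x\<bar> \<le> B"
    unfolding is_heat_kernel_def by blast
  have K0: "K 0 x = of_bool (x = x0)" if "x \<in> verts X" for x
    using K that by (simp add: is_heat_kernel_def)
  note fin = AE_nonneg_of_bounded_Laplace(1)[OF sets int B[OF _ x0], simplified]
  note nonneg = AE_nonneg_of_bounded_Laplace(2)[OF sets int B[OF _ x0], simplified]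
  have mom: "has_bochner_integral \<mu> (\<lambda>l. l ^ j) ((laplacian X q ^^ j) (K 0) x0)" for j
    using moments_of_Laplace_derivatives[where G = "\<lambda>j t. (laplacian X q ^^ j) (K t) x0",
        OF sets nonneg _ heat_kernel_derivative[OF K x0], of 0 j] int
    by simp
  have "represents \<mu> x0 (\<lambda>_. 1) (K 0)"
    using mom by (simp add: represents_def)
  then show "represents \<mu> x0 (\<lambda>_. 1) (\<lambda>x. of_bool (x = x0))"
    by (rule represents_cong) (use K0 x0 in auto)
  have "AE l in \<mu>. l \<le> 2 * (real q + 1)"
    by (rule AE_le_of_moment_growth[OF sets fin nonneg mom, of B])
      (use iterated_laplacian_bound[OF B x0] in auto)
  with nonneg show "AE l in \<mu>. \<bar>real q + 1 - l\<bar> \<le> real q + 1"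
    by eventually_elim auto
  have "integral\<^sup>L \<mu> (\<lambda>_. 1 :: real) = 1"
    using mom[of 0] K0[OF x0] by (simp add: has_bochner_integral_iff)
  then show "measure \<mu> (space \<mu>) = 1"
    by simp
  show "finite_measure \<mu>" by (rule fin)
qed

end

section \<open>Walk polynomials and power sums of roots\<close>

text \<open>
  The polynomials with \<open>nb_poly q n\<close> applied to the adjacency operator of a \<open>(q + 1)\<close>-regular graph counting
  non-backtracking walks of length \<open>n + 1\<close>.
\<close>

fun nb_poly :: "real \<Rightarrow> nat \<Rightarrow> real \<Rightarrow> real" where
  "nb_poly q 0 a = a"
| "nb_poly q (Suc 0) a = a\<^sup>2 - (q + 1)"
| "nb_poly q (Suc (Suc n)) a = a * nb_poly q (Suc n) a - q * nb_poly q n a"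

text \<open>
  The power sums \<open>\<alpha> ^ n + \<beta> ^ n\<close> of the roots of \<open>z\<^sup>2 - a z + q\<close>, as polynomials in \<open>a\<close>.
\<close>

fun lucas_poly :: "real \<Rightarrow> nat \<Rightarrow> real \<Rightarrow> real" where
  "lucas_poly q 0 a = 2"
| "lucas_poly q (Suc 0) a = a"
| "lucas_poly q (Suc (Suc n)) a = a * lucas_poly q (Suc n) a - q * lucas_poly q n a"

text \<open>
  Both sides satisfy the three-term recursion with coefficients \<open>a\<close> and \<open>- q\<close> and agree for \<open>n = 0\<close> and \<open>n = 1\<close>.
\<close>

lemma lucas_poly_nb_poly:
  "nb_poly q (Suc (Suc n)) a - q * nb_poly q n a =
     lucas_poly q (Suc (Suc (Suc n))) a - lucas_poly q (Suc n) a"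
proof (induction n rule: induct_nat_012)
  case (ge2 n)
  have "nb_poly q (Suc (Suc (Suc (Suc n)))) a - q * nb_poly q (Suc (Suc n)) a =
    a * (nb_poly q (Suc (Suc (Suc n))) a - q * nb_poly q (Suc n) a)
    - q * (nb_poly q (Suc (Suc n)) a - q * nb_poly q n a)"
    by (simp add: algebra_simps)
  also have "\<dots> = lucas_poly q (Suc (Suc (Suc (Suc (Suc n))))) a - lucas_poly q (Suc (Suc (Suc n))) a"
    unfolding ge2.IH by (simp add: algebra_simps)
  finally show ?case .
qed (auto simp: algebra_simps power2_eq_square)

lemma lucas_poly_roots:
  assumes "\<alpha> + \<beta> = complex_of_real a" "\<alpha> * \<beta> = complex_of_real q"
  shows "complex_of_real (lucas_poly q n a) = \<alpha> ^ n + \<beta> ^ n"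
proof (induction n rule: induct_nat_012)
  case (ge2 n)
  show ?case
    by (simp add: ge2.IH assms[symmetric] algebra_simps)
qed (use assms in auto)

text \<open>
  The bound \<open>q + 2\<close> is not sharp; it comes directly from \<open>\<bar>z\<bar>\<^sup>2 \<le> (q + 1) \<bar>z\<bar> + q\<close>, and any
  bound gives a positive radius of convergence.
\<close>

lemma roots_exist:
  fixes a :: real and q :: nat
  assumes a: "\<bar>a\<bar> \<le> real q + 1"
  obtains \<alpha> \<beta> where "\<alpha> + \<beta> = complex_of_real a" "\<alpha> * \<beta> = of_nat q"
    "norm \<alpha> \<le> real q + 2" "norm \<beta> \<le> real q + 2"
proof -
  define d where "d = csqrt (of_real (a\<^sup>2 - 4 * q))"
  define \<alpha> where "\<alpha> = (of_real a + d) / 2"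
  define \<beta> where "\<beta> = (of_real a - d) / 2"
  have d2: "d * d = of_real (a\<^sup>2 - 4 * q)"
    using power2_csqrt[of "of_real (a\<^sup>2 - 4 * q)"] by (simp only: d_def power2_eq_square)
  have 1: "\<alpha> + \<beta> = of_real a" by (simp add: \<alpha>_def \<beta>_def field_simps)
  have "\<alpha> * \<beta> = (of_real a * of_real a - d * d) / 4"
    by (simp add: \<alpha>_def \<beta>_def algebra_simps)
  also have "\<dots> = of_nat q"
    unfolding d2 by (simp add: power2_eq_square)
  finally have 2: "\<alpha> * \<beta> = of_nat q" .
  have bound: "norm z \<le> real q + 2" if "z * z = of_real a * z - of_nat q" for z :: complex
  proof (rule ccontr)
    assume "\<not> norm z \<le> real q + 2"
    then have z: "norm z > real q + 2" by simp
    have "norm z * norm z = norm (of_real a * z - of_nat q)"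
      using that by (metis norm_mult)
    also have "\<dots> \<le> \<bar>a\<bar> * norm z + real q"
      using norm_triangle_ineq4[of "of_real a * z" "of_nat q"] by (simp add: norm_mult)
    also have "\<dots> \<le> (real q + 1) * norm z + real q"
      using a by (simp add: mult_right_mono)
    also have "\<dots> < (real q + 1) * norm z + norm z"
      using z by simp
    also have "\<dots> = (real q + 2) * norm z" by (simp add: algebra_simps)
    also have "\<dots> \<le> norm z * norm z"
      using z by (intro mult_right_mono) auto
    finally show False by simp
  qed
  have "\<alpha> * \<alpha> = of_real a * \<alpha> - of_nat q" "\<beta> * \<beta> = of_real a * \<beta> - of_nat q"
    by (simp_all add: 1[symmetric] 2[symmetric] algebra_simps)
  then show ?thesis
    using that[OF 1 2] bound by blast
qed

section \<open>Logarithmic series\<close>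

lemma neg_Ln_one_minus_sums:
  fixes z :: complex
  assumes "norm z < 1"
  shows "(\<lambda>n. z ^ Suc n / of_nat (Suc n)) sums - Ln (1 - z)"
proof -
  have "(\<lambda>n. - (z ^ n / of_nat n)) sums Ln (1 - z)"
    using Ln_series'[of "- z"] assms by simp
  from sums_minus[OF this] have "(\<lambda>n. z ^ n / of_nat n) sums - Ln (1 - z)"
    by simp
  then show ?thesis
    by (subst sums_Suc_iff) simp
qed

text \<open>
  The logarithm of the product is the sum of the logarithms without a correction by \<open>2 \<pi> \<i>\<close>: each factor
  has positive real part, hence argument less than \<open>\<pi> / 2\<close> in absolute value.
\<close>

lemma power_sums_Ln:
  fixes \<alpha> \<beta> u :: complex
  assumes \<alpha>: "norm (\<alpha> * u) < 1" and \<beta>: "norm (\<beta> * u) < 1"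
  shows "(\<lambda>n. (\<alpha> ^ Suc n + \<beta> ^ Suc n) / of_nat (Suc n) * u ^ Suc n) sums
           - Ln (1 - (\<alpha> + \<beta>) * u + \<alpha> * \<beta> * u\<^sup>2)"
proof -
  have pos: "Re (1 - z) > 0" if "norm z < 1" for z :: complex
    using that complex_Re_le_cmod[of z] by simp
  have "\<bar>Im (Ln (1 - \<alpha> * u))\<bar> < pi / 2" "\<bar>Im (Ln (1 - \<beta> * u))\<bar> < pi / 2"
    using pos[OF \<alpha>] pos[OF \<beta>] Re_Ln_pos_lt by (metis less_irrefl zero_complex.simps(1))+
  moreover have "1 - \<alpha> * u \<noteq> 0" "1 - \<beta> * u \<noteq> 0"
    using pos[OF \<alpha>] pos[OF \<beta>] by (metis less_irrefl zero_complex.simps(1))+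
  ultimately have "Ln ((1 - \<alpha> * u) * (1 - \<beta> * u)) = Ln (1 - \<alpha> * u) + Ln (1 - \<beta> * u)"
    by (intro Ln_times_simple) auto
  moreover have "(1 - \<alpha> * u) * (1 - \<beta> * u) = 1 - (\<alpha> + \<beta>) * u + \<alpha> * \<beta> * u\<^sup>2"
    by (simp add: algebra_simps power2_eq_square)
  moreover have "(\<alpha> * u) ^ Suc n / of_nat (Suc n) + (\<beta> * u) ^ Suc n / of_nat (Suc n) =
      (\<alpha> ^ Suc n + \<beta> ^ Suc n) / of_nat (Suc n) * u ^ Suc n" for n
    unfolding power_mult_distrib by (simp only: add_divide_distrib distrib_right times_divide_eq_left)
  moreover have "(\<lambda>n. (\<alpha> * u) ^ Suc n / of_nat (Suc n) + (\<beta> * u) ^ Suc n / of_nat (Suc n)) sums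
      (- Ln (1 - \<alpha> * u) + - Ln (1 - \<beta> * u))"
    by (intro sums_add neg_Ln_one_minus_sums \<alpha> \<beta>)
  ultimately show ?thesis
    by simp
qed


lemma lucas_poly_sums_Ln:
  fixes a :: real and q :: nat and u :: complex
  assumes a: "\<bar>a\<bar> \<le> real q + 1" and u: "(real q + 2) * norm u < 1"
  shows "(\<lambda>n. of_real (lucas_poly q (Suc n) a) / of_nat (Suc n) * u ^ Suc n) sums
      - Ln (1 - of_real a * u + of_nat q * u\<^sup>2)"
    and "norm (of_real (lucas_poly q (Suc n) a) / of_nat (Suc n) * u ^ Suc n) \<le>
      2 * ((real q + 2) * norm u) ^ Suc n"
proof -
  from roots_exist[OF a] obtain \<alpha> \<beta> where r: "\<alpha> + \<beta> = complex_of_real a" "\<alpha> * \<beta> = of_nat q"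
    "norm \<alpha> \<le> real q + 2" "norm \<beta> \<le> real q + 2" .
  have L: "complex_of_real (lucas_poly q n a) = \<alpha> ^ n + \<beta> ^ n" for n
    using lucas_poly_roots[OF r(1), of "real q"] r(2) by simp
  have "norm (\<alpha> * u) < 1" "norm (\<beta> * u) < 1"
    using r(3,4) u mult_right_mono[of _ "real q + 2" "norm u"] unfolding norm_mult
    by (meson norm_ge_zero order_le_less_trans)+
  from power_sums_Ln[OF this]
  show "(\<lambda>n. of_real (lucas_poly q (Suc n) a) / of_nat (Suc n) * u ^ Suc n) sums
      - Ln (1 - of_real a * u + of_nat q * u\<^sup>2)"
    unfolding L r(1,2) .
  have "norm (complex_of_real (lucas_poly q (Suc n) a)) \<le> norm \<alpha> ^ Suc n + norm \<beta> ^ Suc n"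
    unfolding L norm_power[symmetric] by (rule norm_triangle_ineq)
  also have "\<dots> \<le> 2 * (real q + 2) ^ Suc n"
    using power_mono[OF r(3), of "Suc n"] power_mono[OF r(4), of "Suc n"] by simp
  finally have 1: "norm (complex_of_real (lucas_poly q (Suc n) a)) \<le> 2 * (real q + 2) ^ Suc n" .
  have "norm (of_real (lucas_poly q (Suc n) a) / of_nat (Suc n) * u ^ Suc n) =
      norm (complex_of_real (lucas_poly q (Suc n) a)) / real (Suc n) * norm u ^ Suc n"
    by (simp only: norm_mult norm_divide norm_power norm_of_nat)
  also have "\<dots> \<le> norm (complex_of_real (lucas_poly q (Suc n) a)) / 1 * norm u ^ Suc n"
    by (intro mult_right_mono divide_left_mono) auto
  also have "\<dots> \<le> 2 * (real q + 2) ^ Suc n * norm u ^ Suc n"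
    using 1 by (intro mult_right_mono) auto
  also have "\<dots> = 2 * ((real q + 2) * norm u) ^ Suc n"
    by (simp only: power_mult_distrib mult.assoc)
  finally show "norm (of_real (lucas_poly q (Suc n) a) / of_nat (Suc n) * u ^ Suc n) \<le>
      2 * ((real q + 2) * norm u) ^ Suc n" .
qed

lemma lucas_poly_measurable [measurable]: "(\<lambda>a. lucas_poly q n a) \<in> borel_measurable borel"
  by (induction n rule: induct_nat_012) auto

text \<open>
  The power sums of the pair \<open>1\<close>, \<open>- 1\<close> are twice the indicator of even exponents, so this is another
  instance of the series for power sums. The index \<open>n\<close> belongs to the exponent \<open>n + 1\<close>, hence the condition \<open>odd n\<close>.
\<close>

lemma odd_index_sums_Ln:
  fixes u :: complex
  assumes u: "norm u < 1"
  shows "(\<lambda>n. of_bool (odd n) / of_nat (Suc n) * u ^ Suc n) sums - (Ln (1 - u\<^sup>2) / 2)"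
proof -
  have "(\<lambda>n. (1 ^ Suc n + (- 1) ^ Suc n) / of_nat (Suc n) * u ^ Suc n / 2) sums (- Ln (1 - u\<^sup>2) / 2)"
    using power_sums_Ln[of 1 u "- 1"] u by (intro sums_divide) simp
  moreover have "((1 :: complex) ^ Suc n + (- 1) ^ Suc n) / of_nat (Suc n) * u ^ Suc n / 2 =
      of_bool (odd n) / of_nat (Suc n) * u ^ Suc n" for n
  proof -
    have "(1 :: complex) ^ Suc n + (- 1) ^ Suc n = 2 * of_bool (odd n)"
      by (cases "odd n") auto
    then show ?thesis by (simp del: of_nat_Suc power_Suc)
  qed
  ultimately show ?thesis by simp
qed

text \<open>
  On the support of the measure the power series for \<open>- Ln (1 - a u + q u\<^sup>2)\<close> is dominated by a geometric series that does
  not depend on \<open>a = q + 1 - l\<close>, so it may be integrated term by term.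
\<close>

lemma integral_lucas_series:
  fixes \<mu> :: "real measure" and q :: nat and u :: complex
  assumes sets: "sets \<mu> = sets borel" and fin: "finite_measure \<mu>"
    and supp: "AE l in \<mu>. \<bar>real q + 1 - l\<bar> \<le> real q + 1"
    and u: "(real q + 2) * norm u < 1"
  defines "F \<equiv> \<lambda>l. Ln (1 - (of_nat q + 1 - of_real l) * u + of_nat q * u\<^sup>2)"
  shows "integrable \<mu> F"
    and "(\<lambda>n. of_real (LINT l|\<mu>. lucas_poly q (Suc n) (real q + 1 - l)) / of_nat (Suc n) * u ^ Suc n)
      sums - (LINT l|\<mu>. F l)"
proof -
  interpret finite_measure \<mu> by fact
  have [measurable_cong]: "sets \<mu> = sets borel" by fact
  define \<rho> where "\<rho> = (real q + 2) * norm u"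
  have \<rho>: "0 \<le> \<rho>" "\<rho> < 1" using u by (auto simp: \<rho>_def)
  define f where "f = (\<lambda>n l. of_real (lucas_poly q (Suc n) (real q + 1 - l)) / of_nat (Suc n) * u ^ Suc n)"
  have fm [measurable]: "f n \<in> borel_measurable \<mu>" for n
    unfolding f_def by measurable
  have F [measurable]: "F \<in> borel_measurable \<mu>"
    unfolding F_def by measurable
  have bound: "AE l in \<mu>. norm (f n l) \<le> 2 * \<rho> ^ Suc n" for n
    using supp
  proof eventually_elim
    case (elim l)
    from lucas_poly_sums_Ln(2)[OF this u] show ?case unfolding f_def \<rho>_def .
  qed
  have fsums: "AE l in \<mu>. (\<lambda>n. f n l) sums - F l"
    using supp
  proof eventually_elim
    case (elim l)
    from lucas_poly_sums_Ln(1)[OF this u] show ?case unfolding f_def F_def by simp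
  qed
  have geom: "summable (\<lambda>n. 2 * \<rho> ^ Suc n)"
    using \<rho> by (intro summable_mult) (simp add: summable_Suc_iff summable_geometric)
  have int: "integrable \<mu> (f n)" for n
    by (rule integrable_const_bound[OF bound fm])
  have summ: "AE l in \<mu>. summable (\<lambda>n. norm (f n l))"
  proof -
    have "AE l in \<mu>. \<forall>n. norm (f n l) \<le> 2 * \<rho> ^ Suc n"
      using bound by (simp add: AE_all_countable)
    then show ?thesis
    proof eventually_elim
      case (elim l)
      then show ?case by (intro summable_comparison_test'[OF geom, of 0]) auto
    qed
  qed
  have "summable (\<lambda>n. \<integral>l. norm (f n l) \<partial>\<mu>)"
  proof (rule summable_comparison_test')
    show "summable (\<lambda>n. 2 * \<rho> ^ Suc n * measure \<mu> (space \<mu>))"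
      using geom by (rule summable_mult2)
    fix n
    have "(\<integral>l. norm (f n l) \<partial>\<mu>) \<le> (\<integral>l. 2 * \<rho> ^ Suc n \<partial>\<mu>)"
      by (intro integral_mono_AE integrable_norm int bound) auto
    then show "norm (\<integral>l. norm (f n l) \<partial>\<mu>) \<le> 2 * \<rho> ^ Suc n * measure \<mu> (space \<mu>)"
      by (simp add: mult_ac)
  qed
  note series = integrable_suminf[OF int summ this] sums_integral[OF int summ this]
  have eq: "AE l in \<mu>. (\<Sum>n. f n l) = - F l"
    using fsums by eventually_elim (simp add: sums_iff)
  have "integrable \<mu> (\<lambda>l. - F l)"
    using series(1) by (rule integrable_cong_AE_imp) (use eq in auto)
  from Bochner_Integration.integrable_minus[OF this] show "integrable \<mu> F" by simp
  have "(\<integral>l. (\<Sum>n. f n l) \<partial>\<mu>) = (\<integral>l. - F l \<partial>\<mu>)"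
    by (rule integral_cong_AE) (use eq series(1) in auto)
  with series(2) have "(\<lambda>n. integral\<^sup>L \<mu> (f n)) sums - (LINT l|\<mu>. F l)"
    by simp
  moreover have "integral\<^sup>L \<mu> (f n) =
      of_real (LINT l|\<mu>. lucas_poly q (Suc n) (real q + 1 - l)) / of_nat (Suc n) * u ^ Suc n" for n
    unfolding f_def by simp
  ultimately show "(\<lambda>n. of_real (LINT l|\<mu>. lucas_poly q (Suc n) (real q + 1 - l)) / of_nat (Suc n) * u ^ Suc n)
      sums - (LINT l|\<mu>. F l)"
    by simp
qed

section \<open>The zeta function\<close>

context regular_bidirected
begin

text \<open>
  The recursion of the polynomials mirrors that of the walk counts, with multiplication by \<open>q + 1 - l\<close> on one side and
  the adjacency operator on the other.
\<close>

lemma represents_nb_between: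
  assumes "represents \<mu> x0 (\<lambda>_. 1) (\<lambda>x. of_bool (x = x0))" "x0 \<in> verts X"
  shows "represents \<mu> x0 (\<lambda>l. nb_poly q n (real q + 1 - l)) (\<lambda>x. nb_between n x x0)"
proof (induction n rule: induct_nat_012)
  case 0
  from represents_adjacency[OF assms(1)] show ?case
    by (simp add: nb_between_0)
next
  case 1
  have eq: "(\<lambda>l. 1 * ((real q + 1 - l) * ((real q + 1 - l) * 1)) + - (real q + 1) * 1) =
      (\<lambda>l. nb_poly q (Suc 0) (real q + 1 - l))"
    by (simp add: fun_eq_iff power2_eq_square)
  have "represents \<mu> x0 (\<lambda>l. nb_poly q (Suc 0) (real q + 1 - l))
      (\<lambda>x. 1 * adjacency (\<lambda>x. nb_between 0 x x0) x + - (real q + 1) * of_bool (x = x0))"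
    unfolding eq[symmetric] nb_between_0
    by (rule represents_linear[OF represents_adjacency[OF represents_adjacency[OF assms(1)]] assms(1)])
  then show ?case
    by (rule represents_cong[OF _ assms(2)]) (simp add: nb_between_1)
next
  case (ge2 n)
  from represents_linear[OF represents_adjacency[OF ge2.IH(2)] ge2.IH(1), of 1 "- real q"]
  have "represents \<mu> x0 (\<lambda>l. nb_poly q (Suc (Suc n)) (real q + 1 - l))
      (\<lambda>x. 1 * adjacency (\<lambda>x. nb_between (Suc n) x x0) x + - real q * nb_between n x x0)"
    by simp
  then show ?case
    by (rule represents_cong[OF _ assms(2)]) (simp add: nb_between_rec)
qed

text \<open>
  In finite-graph language, this says that a pair of roots \<open>\<alpha>\<close>, \<open>\<beta>\<close> and the eigenvalues \<open>1\<close>, \<open>- 1\<close>, each with weight \<open>(q - 1) / 2\<close>,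
  make up the spectrum of the non-backtracking operator per vertex.
\<close>

lemma num_closed_geodesics_integral:
  assumes vt: "vertex_transitive X bar" and x0: "x0 \<in> verts X"
    and rep: "represents \<mu> x0 (\<lambda>_. 1) (\<lambda>x. of_bool (x = x0))"
  shows "has_bochner_integral \<mu>
      (\<lambda>l. lucas_poly q (Suc n) (real q + 1 - l) + (real q - 1) * of_bool (odd n))
      (num_closed_geodesics X bar x0 (Suc n))"
  unfolding num_closed_geodesics_eq[OF x0]
proof (induction n rule: induct_nat_012)
  case 0
  then show ?case
    using representsD[OF represents_nb_between[OF rep x0, of 0]]
    by (simp add: nb_cyclic_0 nb_between_same)
next
  case 1
  then show ?case
    using representsD[OF represents_nb_between[OF rep x0, of 1]]
    by (simp add: nb_cyclic_1 nb_between_same power2_eq_square algebra_simps)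
next
  case (ge2 n)
  define a where "a = (\<lambda>l. real q + 1 - l)"
  note c = representsD[OF represents_nb_between[OF rep x0], unfolded nb_between_same]
  have "has_bochner_integral \<mu>
      (\<lambda>l. nb_poly q (Suc (Suc n)) (a l) - q * nb_poly q n (a l)
         + (lucas_poly q (Suc n) (a l) + (real q - 1) * of_bool (odd n)))
      (nb_closed (Suc (Suc n)) x0 - q * nb_closed n x0 + nb_cyclic n x0)"
    unfolding a_def
    by (intro has_bochner_integral_add has_bochner_integral_diff has_bochner_integral_mult_right c ge2.IH)
  also have "(\<lambda>l. nb_poly q (Suc (Suc n)) (a l) - q * nb_poly q n (a l)
         + (lucas_poly q (Suc n) (a l) + (real q - 1) * of_bool (odd n))) =
      (\<lambda>l. lucas_poly q (Suc (Suc (Suc n))) (a l) + (real q - 1) * of_bool (odd (Suc (Suc n))))"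
    unfolding lucas_poly_nb_poly by (simp del: lucas_poly.simps)
  also have "nb_closed (Suc (Suc n)) x0 - q * nb_closed n x0 + nb_cyclic n x0 = nb_cyclic (Suc (Suc n)) x0"
    using nb_cyclic_rec[OF nb_closed_const[OF vt] x0] by simp
  finally show ?case unfolding a_def .
qed

lemma log_zeta_sums:
  assumes vt: "vertex_transitive X bar" and x0: "x0 \<in> verts X"
    and \<mu>: "is_spectral_measure X q x0 \<mu>"
    and u: "(real q + 2) * norm u < 1"
  shows "log_zeta_term X bar x0 u sums
    - ((LINT l|\<mu>. Ln (1 - (of_nat q + 1 - of_real l) * u + of_nat q * u\<^sup>2))
       + (of_nat q - 1) / 2 * Ln (1 - u\<^sup>2))"
proof -
  note \<mu>' = spectral_measure_properties[OF \<mu> x0]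
  have sets: "sets \<mu> = sets borel" using \<mu> by (simp add: is_spectral_measure_def)
  interpret finite_measure \<mu> by (rule \<mu>'(1))
  define L where "L n = (LINT l|\<mu>. lucas_poly q (Suc n) (real q + 1 - l))" for n
  have N: "real (num_closed_geodesics X bar x0 (Suc n)) = L n + (real q - 1) * of_bool (odd n)" for n
  proof -
    note i = num_closed_geodesics_integral[OF vt x0 \<mu>'(4), of n]
    have "integrable \<mu> (\<lambda>l. lucas_poly q (Suc n) (real q + 1 - l) + (real q - 1) * of_bool (odd n)
        - (real q - 1) * of_bool (odd n))"
      using i by (intro Bochner_Integration.integrable_diff) (auto simp: has_bochner_integral_iff)
    then have int: "integrable \<mu> (\<lambda>l. lucas_poly q (Suc n) (real q + 1 - l))"
      by simp
    have "real (num_closed_geodesics X bar x0 (Suc n)) =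
        (LINT l|\<mu>. lucas_poly q (Suc n) (real q + 1 - l) + (real q - 1) * of_bool (odd n))"
      using has_bochner_integral_integral_eq[OF i] by simp
    also have "\<dots> = L n + (real q - 1) * of_bool (odd n)"
      using int \<mu>'(2) by (simp add: L_def del: lucas_poly.simps)
    finally show ?thesis .
  qed
  have u1: "norm u < 1"
  proof -
    have "norm u \<le> (real q + 2) * norm u"
      using mult_right_mono[of 1 "real q + 2" "norm u"] by simp
    with u show ?thesis by linarith
  qed
  have "(\<lambda>n. of_real (L n) / of_nat (Suc n) * u ^ Suc n
        + (of_nat q - 1) * (of_bool (odd n) / of_nat (Suc n) * u ^ Suc n)) sums
      (- (LINT l|\<mu>. Ln (1 - (of_nat q + 1 - of_real l) * u + of_nat q * u\<^sup>2))
        + (of_nat q - 1) * - (Ln (1 - u\<^sup>2) / 2))"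
    unfolding L_def
    by (intro sums_add sums_mult odd_index_sums_Ln[OF u1] integral_lucas_series(2)[OF sets \<mu>'(1,3) u])
  moreover have "of_real (L n) / of_nat (Suc n) * u ^ Suc n
        + (of_nat q - 1) * (of_bool (odd n) / of_nat (Suc n) * u ^ Suc n) =
      log_zeta_term X bar x0 u n" for n
  proof -
    have "complex_of_nat (num_closed_geodesics X bar x0 (Suc n)) =
        of_real (L n) + (of_nat q - 1) * of_bool (odd n)"
      using arg_cong[OF N[of n], of complex_of_real] by simp
    then show ?thesis
      unfolding log_zeta_term_def by (simp add: add_divide_distrib distrib_right)
  qed
  ultimately show ?thesis
    by simp
qed

end

theorem theorem1p3:
  fixes X :: "('a, 'b) pre_digraph" and bar :: "'b \<Rightarrow> 'b"
    and q :: nat and x0 :: 'a and \<mu> :: "real measure"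
  assumes "bidirected_digraph X bar"
    and "q > 0"
    and "regular_graph X (q + 1)"
    and "vertex_transitive X bar"
    and "x0 \<in> verts X"
    and "is_spectral_measure X q x0 \<mu>"
  shows "\<exists>r>0. \<forall>u::complex. norm u < r \<longrightarrow>
           summable (log_zeta_term X bar x0 u) \<and>
           integrable \<mu> (\<lambda>l. Ln (1 - (of_nat q + 1 - of_real l) * u + of_nat q * u\<^sup>2)) \<and>
           inverse (graph_zeta X bar x0 u) =
             (1 - u\<^sup>2) powr ((of_nat q - 1) / 2) *
             exp (LINT l|\<mu>. Ln (1 - (of_nat q + 1 - of_real l) * u + of_nat q * u\<^sup>2))"
proof (intro exI[of _ "1 / (real q + 2)"] conjI allI impI)
  interpret regular_bidirected X bar q
    using assms by (simp add: regular_bidirected_def regular_bidirected_axioms_def)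
  \<comment> \<open>Roots of modulus at most q + 2 make the logarithmic series converge for (q + 2) |u| < 1.\<close>
  show "1 / (real q + 2) > 0" by simp
  fix u :: complex assume "norm u < 1 / (real q + 2)"
  then have u: "(real q + 2) * norm u < 1"
    by (simp add: field_simps)
  note \<mu> = spectral_measure_properties[OF assms(6,5)]
  have sets: "sets \<mu> = sets borel" using assms(6) by (simp add: is_spectral_measure_def)
  note sums = log_zeta_sums[OF assms(4-6) u]
  show "summable (log_zeta_term X bar x0 u)"
    using sums by (rule sums_summable)
  show "integrable \<mu> (\<lambda>l. Ln (1 - (of_nat q + 1 - of_real l) * u + of_nat q * u\<^sup>2))"
    by (rule integral_lucas_series(1)[OF sets \<mu>(1,3) u])
  have "1 - u\<^sup>2 \<noteq> 0"
  proof
    assume "1 - u\<^sup>2 = 0"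
    then have "norm u = 1"
      by (auto simp: power2_eq_1_iff)
    with u show False by simp
  qed
  then show "inverse (graph_zeta X bar x0 u) =
             (1 - u\<^sup>2) powr ((of_nat q - 1) / 2) *
             exp (LINT l|\<mu>. Ln (1 - (of_nat q + 1 - of_real l) * u + of_nat q * u\<^sup>2))"
    unfolding graph_zeta_def sums_unique[OF sums, symmetric] exp_minus inverse_inverse_eq exp_add
    by (simp add: powr_def mult.commute)
qed

end
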